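(* For every integer $t\geq 1$ let $f_t$ be the number of $(t,t+1,t+2)$-core partitions, and set $f_0=1$. Then for every $t\geq 0$, $f_t$ is the $t$-th Motzkin number, that is, $$f_t=\sum_{0\leq k\leq \lfloor t/2\rfloor}\frac{1}{k+1}\binom{t}{2k}\binom{2k}{k},$$ and the generating function of $f_t$ is $$\sum_{t\geq 0}f_tx^t=\frac{1-x-\sqrt{1-2x-3x^2}}{2x^2}$$ (as a formal power series in $x$).
   Context: A partition is a finite non-increasing sequence of positive integers $\lambda=(\lambda_1,\ldots,\lambda_r)$; the empty partition ($r=0$) is allowed. Its Young diagram is the left-justified array of boxes with $\lambda_i$ boxes in the $i$-th row. The hook length of a box is the number of boxes that are directly to its right in the same row, or directly below it in the same column, or the box itself. For a positive integer $t$, $\lambda$ is a $t$-core partition if none of its hook lengths is a multiple of $t$ (so the empty partition is a $t$-core for every $t$). $\lambda$ is a $(t_1,\ldots,t_m)$-core partition if it is simultaneously a $t_i$-core partition for every $1\leq i\leq m$. Partitions of all sizes are counted together. The square root of a formal power series with constant term $1$ is the one with constant term $1$. *)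

theory Defs
  imports Complex_Main "HOL-Computational_Algebra.Formal_Power_Series"
begin

definition is_partition :: "nat list \<Rightarrow> bool" where
  "is_partition p \<longleftrightarrow> sorted_wrt (\<ge>) p \<and> (\<forall>x\<in>set p. x > 0)"

text \<open>Boxes are pairs (row, column), both counted from 0.\<close>

definition young_diagram :: "nat list \<Rightarrow> (nat \<times> nat) set" where
  "young_diagram p = {(i, j). i < length p \<and> j < p ! i}"

definition hook :: "nat list \<Rightarrow> nat \<times> nat \<Rightarrow> (nat \<times> nat) set" where
  "hook p b = {(i, j) \<in> young_diagram p.
     i = fst b \<and> j \<ge> snd b \<or> j = snd b \<and> i \<ge> fst b}"

definition hook_length :: "nat list \<Rightarrow> nat \<times> nat \<Rightarrow> nat" where
  "hook_length p b = card (hook p b)"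

definition is_core :: "nat \<Rightarrow> nat list \<Rightarrow> bool" where
  "is_core t p \<longleftrightarrow> (\<forall>b\<in>young_diagram p. \<not> t dvd hook_length p b)"

definition simultaneous_cores :: "nat list \<Rightarrow> nat list set" where
  "simultaneous_cores ts = {p. is_partition p \<and> (\<forall>t\<in>set ts. is_core t p)}"

text \<open>
  On formal power series over a field, division by a series of subdegree \<open>n\<close> discards the
  coefficients of the numerator below \<open>n\<close>. A quotient \<open>f / g\<close> therefore only has its usual
  meaning, namely the unique \<open>q\<close> with \<open>g * q = f\<close>, together with \<open>g dvd f\<close>.

  \<open>fps_radical root 2 a\<close> takes \<open>sqrt\<close> of the constant coefficient of \<open>a\<close> as its constant
  coefficient; so for \<open>a\<close> with constant coefficient 1 it is the square root with constant
  coefficient 1.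
\<close>

end

theory Submission
  imports Defs
begin

text \<open>
  A partition is determined by its set of first-column hook lengths, which can be any finite set of
  positive integers, and it is a \<open>t\<close>-core iff this set is closed under subtracting \<open>t\<close>. So the
  \<open>(t, t+1, t+2)\<close>-cores correspond to the order ideals of the poset of gaps of the numerical
  semigroup generated by \<open>t\<close>, \<open>t+1\<close>, \<open>t+2\<close>, a triangle with rows of \<open>t-1, t-3, t-5, \<dots>\<close> cells.
  Cutting an ideal at the first cell missing from its bottom row splits it into two smaller ideals,
  which gives \<open>F = 1 + x F + x^2 F^2\<close> for the generating function. The closed formula satisfies the
  same equation, by way of the Catalan series.
\<close>

section \<open>First-column hook lengths\<close>

text \<open>The first box of a row of length \<open>x\<close> with \<open>length p\<close> rows
  below it has hook length \<open>x + length p\<close>.\<close>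

fun beta_set :: "nat list \<Rightarrow> nat set" where
  "beta_set [] = {}"
| "beta_set (x # p) = insert (x + length p) (beta_set p)"

lemma is_partition_Nil [simp]: "is_partition []"
  by (simp add: is_partition_def)

lemma is_partition_Cons:
  "is_partition (x # p) \<longleftrightarrow> 0 < x \<and> (\<forall>y\<in>set p. y \<le> x) \<and> is_partition p"
  by (auto simp: is_partition_def)

lemma beta_set_less:
  "\<lbrakk>is_partition p; \<forall>y\<in>set p. y \<le> x; b \<in> beta_set p\<rbrakk> \<Longrightarrow> b < x + length p"
proof (induction p arbitrary: x)
  case (Cons y p)
  then show ?case by (fastforce simp: is_partition_Cons)
qed simp

lemma finite_beta_set [simp]: "finite (beta_set p)"
  by (induction p) auto

lemma zero_notin_beta_set: "is_partition p \<Longrightarrow> 0 \<notin> beta_set p"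
  by (induction p) (auto simp: is_partition_Cons)

lemma beta_set_Cons_notin: "is_partition (x # p) \<Longrightarrow> x + length p \<notin> beta_set p"
  using beta_set_less[of p x "x + length p"] by (auto simp: is_partition_Cons)

lemma card_beta_set: "is_partition p \<Longrightarrow> card (beta_set p) = length p"
proof (induction p)
  case (Cons x p)
  then show ?case using beta_set_Cons_notin[of x p] by (simp add: is_partition_Cons)
qed simp

lemma Max_beta_set: "is_partition (x # p) \<Longrightarrow> Max (beta_set (x # p)) = x + length p"
  using beta_set_less[of p x] by (intro Max_eqI) (auto simp: is_partition_Cons intro: less_imp_le)

text \<open>The cardinality is the number of rows and the maximum belongs to the first row, so
  together they determine that row; removing the maximum leaves the set of the remaining
  rows.\<close>

lemma beta_set_inj:
  "\<lbrakk>is_partition p; is_partition q; beta_set p = beta_set q\<rbrakk> \<Longrightarrow> p = q"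
proof (induction p arbitrary: q)
  case Nil
  then show ?case by (cases q) auto
next
  case (Cons x p)
  then obtain y q' where q: "q = y # q'" by (cases q) auto
  have parts: "is_partition p" "is_partition q'" using Cons.prems q by (auto simp: is_partition_Cons)
  have "length (x # p) = length (y # q')" using Cons.prems q card_beta_set by metis
  moreover have "x + length p = y + length q'" using Cons.prems q Max_beta_set by metis
  ultimately have "x = y" "length p = length q'" by auto
  moreover have "x + length p \<notin> beta_set p" "y + length q' \<notin> beta_set q'"
    using beta_set_Cons_notin Cons.prems q by blast+
  ultimately have "beta_set p = beta_set q'"
    using Cons.prems(3) q by (simp add: insert_ident)
  then show ?case using Cons.IH[OF parts] \<open>x = y\<close> q by simp
qed

text \<open>Induction by adding a new maximum \<open>m\<close>: on top of the rows \<open>p\<close>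
  it must come from a row of length \<open>m - length p\<close>.\<close>

lemma beta_set_surj:
  assumes "finite B" "0 \<notin> B"
  shows "\<exists>p. is_partition p \<and> beta_set p = B"
  using assms
proof (induction B rule: finite_linorder_max_induct)
  case empty
  show ?case by (rule exI[of _ "[]"]) simp
next
  case (insert m B)
  then obtain p where p: "is_partition p" "beta_set p = B" by auto
  \<comment> \<open>\<open>B\<close> fits into \<open>m - 1\<close> positive places, so the new row
    is nonempty.\<close>
  have "B \<subseteq> {1..<m}" using insert.hyps insert.prems by (auto simp: Suc_le_eq intro: gr0I)
  then have "card B \<le> card {1..<m}" by (intro card_mono) auto
  moreover have "0 < m" using insert.prems by auto
  ultimately have len: "length p < m" using p card_beta_set[of p] by auto
  have "\<forall>y\<in>set p. y \<le> m - length p"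
  proof (cases p)
    case (Cons y q)
    then have "y + length q < m" using p insert.hyps by auto
    then have "y \<le> m - length p" using Cons by simp
    moreover have "\<forall>z\<in>set p. z \<le> y" using Cons p(1) by (auto simp: is_partition_Cons)
    ultimately show ?thesis by fastforce
  qed simp
  then have "is_partition ((m - length p) # p)" using p len by (auto simp: is_partition_Cons)
  moreover have "beta_set ((m - length p) # p) = insert m B" using len p by simp
  ultimately show ?case by blast
qed

lemma bij_betw_beta_set:
  "bij_betw beta_set {p. is_partition p} {B. finite B \<and> 0 \<notin> B}"
proof (rule bij_betw_imageI)
  show "inj_on beta_set {p. is_partition p}"
    by (auto intro!: inj_onI beta_set_inj)
  show "beta_set ` {p. is_partition p} = {B. finite B \<and> 0 \<notin> B}"
    using beta_set_surj by (fastforce simp: zero_notin_beta_set)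
qed

section \<open>Gaps of the beta set and hook lengths\<close>

definition column_length :: "nat list \<Rightarrow> nat \<Rightarrow> nat" where
  "column_length p j = length (filter (\<lambda>y. j < y) p)"

lemma column_length_le: "column_length p j \<le> length p"
  by (simp add: column_length_def)

lemma column_length_antimono: "i \<le> j \<Longrightarrow> column_length p j \<le> column_length p i"
  by (induction p) (auto simp: column_length_def)

text \<open>Number the steps of the boundary path from the lower left end of the diagram, starting
  at 0. The vertical steps get the elements of \<open>beta_set p\<close>; the horizontal step of
  column \<open>j\<close> gets \<open>j\<close> plus the number of rows of length at most
  \<open>j\<close>.\<close>

lemma column_gap_notin_beta_set:
  "is_partition p \<Longrightarrow> j + length p - column_length p j \<notin> beta_set p"
proof (induction p)
  case (Cons y p)
  then have p: "is_partition p" "\<forall>z\<in>set p. z \<le> y" by (auto simp: is_partition_Cons)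
  show ?case
  proof (cases "j < y")
    case True
    then have "j + length (y # p) - column_length (y # p) j = j + length p - column_length p j"
      by (simp add: column_length_def)
    moreover have "j + length p - column_length p j < y + length p" using True by simp
    ultimately show ?thesis using Cons.IH[OF p(1)] by auto
  next
    case False
    then have "column_length (y # p) j = 0"
      using p(2) by (auto simp: column_length_def filter_empty_conv)
    moreover have "j + length (y # p) \<notin> beta_set (y # p)"
      using beta_set_less[of "y # p" j "j + length (y # p)"] False p Cons.prems by fastforce
    ultimately show ?thesis by simp
  qed
qed simp

text \<open>Distinct columns give distinct gaps, and removing \<open>length p\<close> elements from
  \<open>x + length p\<close> numbers leaves exactly \<open>x\<close>, so inclusion forces
  equality.\<close>

lemma column_gaps_image:
  assumes "is_partition (x # p)"
  shows "(\<lambda>j. j + length p - column_length p j) ` {..<x} = {..<x + length p} - beta_set p"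
proof (rule card_subset_eq)
  let ?g = "\<lambda>j. j + length p - column_length p j"
  have p: "is_partition p" "\<forall>z\<in>set p. z \<le> x" using assms by (auto simp: is_partition_Cons)
  have "strict_mono ?g"
  proof (rule strict_monoI)
    fix i j :: nat assume "i < j"
    then show "?g i < ?g j"
      using column_length_antimono[of i j p] column_length_le[of p i] column_length_le[of p j] by linarith
  qed
  then have "inj_on ?g {..<x}" by (meson strict_mono_imp_inj_on)
  then have "card (?g ` {..<x}) = x" by (simp add: card_image)
  moreover have "card ({..<x + length p} - beta_set p) = x"
    using beta_set_less[OF p] card_beta_set[OF p(1)] by (subst card_Diff_subset) auto
  ultimately show "card (?g ` {..<x}) = card ({..<x + length p} - beta_set p)" by simp
  show "?g ` {..<x} \<subseteq> {..<x + length p} - beta_set p"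
    using column_gap_notin_beta_set[OF p(1)] by auto
qed simp

lemma hook_length_Cons_0:
  assumes "j < x"
  shows "hook_length (x # p) (0, j) = x - j + column_length p j"
proof -
  let ?C = "{i. i < length p \<and> j < p ! i}"
  have "hook (x # p) (0, j) = Pair 0 ` {j..<x} \<union> (\<lambda>i. (Suc i, j)) ` ?C" (is "_ = ?A \<union> ?B")
  proof (intro set_eqI)
    fix b :: "nat \<times> nat"
    obtain i k where "b = (i, k)" by force
    then show "b \<in> hook (x # p) (0, j) \<longleftrightarrow> b \<in> ?A \<union> ?B"
      using assms by (cases i) (auto simp: hook_def young_diagram_def)
  qed
  moreover have "card ?A = x - j" by (subst card_image) (auto intro: inj_onI)
  moreover have "card ?B = column_length p j"
    by (subst card_image) (auto intro: inj_onI simp: column_length_def length_filter_conv_card)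
  moreover have "?A \<inter> ?B = {}" by auto
  ultimately show ?thesis by (simp add: hook_length_def card_Un_disjoint)
qed

lemma hook_length_Cons_Suc: "hook_length (x # p) (Suc i, j) = hook_length p (i, j)"
proof -
  have "hook (x # p) (Suc i, j) = apfst Suc ` hook p (i, j)"
  proof (intro set_eqI)
    fix b :: "nat \<times> nat"
    obtain i' k where "b = (i', k)" by force
    then show "b \<in> hook (x # p) (Suc i, j) \<longleftrightarrow> b \<in> apfst Suc ` hook p (i, j)"
      by (cases i') (auto simp: hook_def young_diagram_def image_iff)
  qed
  moreover have "inj_on (apfst Suc) (hook p (i, j))"
    by (rule inj_on_subset[of _ UNIV]) simp_all
  ultimately show ?thesis
    unfolding hook_length_def by (simp add: card_image)
qed

lemma is_core_Nil: "is_core t []"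
  by (simp add: is_core_def young_diagram_def)

lemma is_core_Cons:
  "is_core t (x # p) \<longleftrightarrow> (\<forall>j<x. \<not> t dvd x - j + column_length p j) \<and> is_core t p"
proof -
  have "young_diagram (x # p) = Pair 0 ` {..<x} \<union> apfst Suc ` young_diagram p"
  proof (intro set_eqI)
    fix b :: "nat \<times> nat"
    obtain i k where "b = (i, k)" by force
    then show "b \<in> young_diagram (x # p) \<longleftrightarrow> b \<in> Pair 0 ` {..<x} \<union> apfst Suc ` young_diagram p"
      by (cases i) (auto simp: young_diagram_def image_iff)
  qed
  then show ?thesis
    by (auto simp: is_core_def ball_Un hook_length_Cons_0 hook_length_Cons_Suc)
qed

text \<open>The hook lengths in the row with first-column hook length \<open>h\<close> are the numbers \<open>h - m\<close>
  for \<open>m < h\<close> outside the beta set.\<close>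

lemma is_core_iff_beta_set_gaps:
  "is_partition p \<Longrightarrow> is_core t p \<longleftrightarrow> (\<forall>h\<in>beta_set p. \<forall>m<h. m \<notin> beta_set p \<longrightarrow> \<not> t dvd h - m)"
proof (induction p)
  case Nil
  show ?case by (simp add: is_core_Nil)
next
  case (Cons x p)
  then have p: "is_partition p" "\<forall>z\<in>set p. z \<le> x" by (auto simp: is_partition_Cons)
  let ?h = "x + length p"
  have "(\<forall>j<x. \<not> t dvd x - j + column_length p j)
      \<longleftrightarrow> (\<forall>m\<in>(\<lambda>j. j + length p - column_length p j) ` {..<x}. \<not> t dvd ?h - m)"
  proof -
    have "x - j + column_length p j = ?h - (j + length p - column_length p j)" if "j < x" for j
      using column_length_le[of p j] that by linarith
    then show ?thesis by (simp add: lessThan_def)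
  qed
  also have "\<dots> \<longleftrightarrow> (\<forall>m<?h. m \<notin> beta_set p \<longrightarrow> \<not> t dvd ?h - m)"
    unfolding column_gaps_image[OF Cons.prems] by auto
  finally have "is_core t (x # p) \<longleftrightarrow> (\<forall>m<?h. m \<notin> beta_set p \<longrightarrow> \<not> t dvd ?h - m) \<and>
      (\<forall>h\<in>beta_set p. \<forall>m<h. m \<notin> beta_set p \<longrightarrow> \<not> t dvd h - m)"
    using Cons.IH[OF p(1)] by (simp add: is_core_Cons)
  \<comment> \<open>Adding \<open>?h\<close> to the beta set excludes no further \<open>m\<close>,
    since every \<open>m\<close> considered is below \<open>?h\<close>.\<close>
  also have "\<dots> \<longleftrightarrow> (\<forall>h\<in>beta_set (x # p). \<forall>m<h. m \<notin> beta_set (x # p) \<longrightarrow> \<not> t dvd h - m)"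
    using beta_set_less[OF p] by auto (metis order.asym)
  finally show ?case .
qed

section \<open>Cores as sets closed under subtraction\<close>

text \<open>The case \<open>h = t\<close> demands \<open>0 \<in> B\<close>, so a closed set without
  \<open>0\<close> cannot contain \<open>t\<close>.\<close>

definition closed_sub :: "nat \<Rightarrow> nat set \<Rightarrow> bool" where
  "closed_sub t B \<longleftrightarrow> (\<forall>h\<in>B. t \<le> h \<longrightarrow> h - t \<in> B)"

lemma closed_sub_mult:
  assumes "closed_sub t B" "h \<in> B" "t * k \<le> h"
  shows "h - t * k \<in> B"
  using assms(3)
proof (induction k)
  case (Suc k)
  then have "h - t * k \<in> B" "t \<le> h - t * k" by auto
  then have "h - t * k - t \<in> B" using assms(1) by (auto simp: closed_sub_def)
  then show ?case by (simp add: add.commute)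
qed (use assms in simp)

text \<open>A missing \<open>h - t\<close> would be a gap at distance exactly \<open>t\<close>.
  Conversely, repeated subtraction of \<open>t\<close> reaches every \<open>m < h\<close> with
  \<open>t dvd h - m\<close>, so no such \<open>m\<close> is a gap.\<close>

lemma is_core_iff_closed_sub:
  assumes "is_partition p" "0 < t"
  shows "is_core t p \<longleftrightarrow> closed_sub t (beta_set p)"
  unfolding is_core_iff_beta_set_gaps[OF assms(1)]
proof (intro iffI ballI allI impI notI)
  assume *: "\<forall>h\<in>beta_set p. \<forall>m<h. m \<notin> beta_set p \<longrightarrow> \<not> t dvd h - m"
  show "closed_sub t (beta_set p)"
    unfolding closed_sub_def
  proof (intro ballI impI, rule ccontr)
    fix h assume h: "h \<in> beta_set p" "t \<le> h" "h - t \<notin> beta_set p"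
    then have "\<not> t dvd h - (h - t)" using * assms(2) by (meson diff_less le_trans less_le_trans)
    then show False using h by simp
  qed
next
  fix h m assume *: "closed_sub t (beta_set p)" "h \<in> beta_set p" "m < h" "m \<notin> beta_set p" "t dvd h - m"
  then obtain k where k: "h - m = t * k" by auto
  then have "h - t * k = m" "t * k \<le> h" using \<open>m < h\<close> by auto
  then show False using closed_sub_mult[OF *(1,2)] *(4) by metis
qed

definition closed_sets :: "nat \<Rightarrow> nat set set" where
  "closed_sets t = {B. finite B \<and> 0 \<notin> B \<and> closed_sub t B \<and> closed_sub (t + 1) B \<and> closed_sub (t + 2) B}"

lemma bij_betw_simultaneous_cores:
  assumes "1 \<le> t"
  shows "bij_betw beta_set (simultaneous_cores [t, t + 1, t + 2]) (closed_sets t)"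
proof (rule bij_betw_subset[OF bij_betw_beta_set])
  show "simultaneous_cores [t, t + 1, t + 2] \<subseteq> {p. is_partition p}"
    by (auto simp: simultaneous_cores_def)
  show "beta_set ` simultaneous_cores [t, t + 1, t + 2] = closed_sets t"
  proof (intro equalityI subsetI)
    fix B assume B: "B \<in> closed_sets t"
    then obtain p where "is_partition p" "beta_set p = B"
      using beta_set_surj[of B] by (auto simp: closed_sets_def)
    then show "B \<in> beta_set ` simultaneous_cores [t, t + 1, t + 2]"
      using B assms by (auto simp: closed_sets_def simultaneous_cores_def is_core_iff_closed_sub)
  qed (use assms in \<open>auto simp: closed_sets_def simultaneous_cores_def is_core_iff_closed_sub zero_notin_beta_set\<close>)
qed

section \<open>Ideals of semigroup gaps\<close>

text \<open>The cell \<open>(k, j)\<close> stands for the number \<open>k * (t + 2) + j + 1\<close>; as \<open>(k, j)\<close> ranges over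
  \<open>cells t\<close>, these are exactly the gaps of the numerical semigroup generated by \<open>t\<close>, \<open>t + 1\<close>
  and \<open>t + 2\<close>. Subtracting \<open>t + 2\<close>, \<open>t + 1\<close>, \<open>t\<close> moves one row down and \<open>0\<close>, \<open>1\<close>, \<open>2\<close> columns to
  the right.\<close>

definition cells :: "nat \<Rightarrow> (nat \<times> nat) set" where
  "cells t = {(k, j). j + 2 * k + 1 < t}"

definition cell_ideals :: "nat \<Rightarrow> (nat \<times> nat) set set" where
  "cell_ideals t = {I. I \<subseteq> cells t \<and>
     (\<forall>k j. (Suc k, j) \<in> I \<longrightarrow> (k, j) \<in> I \<and> (k, j + 1) \<in> I \<and> (k, j + 2) \<in> I)}"

definition cell_value :: "nat \<Rightarrow> nat \<times> nat \<Rightarrow> nat" where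
  "cell_value t = (\<lambda>(k, j). k * (t + 2) + (j + 1))"

lemma finite_cells: "finite (cells t)"
  by (rule finite_subset[of _ "{..<t} \<times> {..<t}"]) (auto simp: cells_def)

lemma finite_cell_ideals: "finite (cell_ideals t)"
  by (rule finite_subset[of _ "Pow (cells t)"]) (auto simp: cell_ideals_def finite_cells)

text \<open>Division with remainder by \<open>t + 2\<close> recovers the cell, since
  \<open>j + 1 < t + 2\<close>.\<close>

lemma inj_on_cell_value: "inj_on (cell_value t) (cells t)"
proof (rule inj_onI)
  fix c c' assume c: "c \<in> cells t" "c' \<in> cells t" and eq: "cell_value t c = cell_value t c'"
  obtain k j k' j' where kj: "c = (k, j)" "c' = (k', j')" by force
  have j: "j + 1 < t + 2" "j' + 1 < t + 2" using c kj by (auto simp: cells_def)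
  let ?x = "k * (t + 2) + (j + 1)"
  have eq': "?x = k' * (t + 2) + (j' + 1)" using eq kj by (simp only: cell_value_def prod.case)
  have divmod: "(a * n + b) div n = a \<and> (a * n + b) mod n = b" if "b < n" for a b n :: nat
    using that by simp
  have "?x div (t + 2) = k \<and> ?x mod (t + 2) = j + 1" by (rule divmod) (rule j)
  moreover have "?x div (t + 2) = k' \<and> ?x mod (t + 2) = j' + 1"
    unfolding eq' by (rule divmod) (rule j)
  ultimately show "c = c'" using kj by simp
qed

text \<open>The intervals \<open>{m * t..m * (t + 2)}\<close> make up the numerical semigroup generated by
  \<open>t\<close>, \<open>t + 1\<close> and \<open>t + 2\<close>.\<close>

lemma closed_sets_avoid_semigroup:
  assumes "B \<in> closed_sets t" "1 \<le> t"
  shows "\<lbrakk>m * t \<le> x; x \<le> m * (t + 2)\<rbrakk> \<Longrightarrow> x \<notin> B"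
proof (induction m arbitrary: x)
  case 0
  then show ?case using assms by (simp add: closed_sets_def)
next
  case (Suc m)
  \<comment> \<open>Subtract \<open>t\<close> if the result is at most \<open>m * (t + 2)\<close>.
    Otherwise subtracting \<open>t + 2\<close> leaves more than \<open>m * (t + 2) - 2\<close>,
    which is at least \<open>m * t\<close> once \<open>m\<close> is positive; for
    \<open>m = 0\<close> the target interval is \<open>{0}\<close> and \<open>d = x\<close>.\<close>
  obtain d where d: "d \<in> {t, t + 1, t + 2}" "d \<le> x" "m * t \<le> x - d" "x - d \<le> m * (t + 2)"
  proof (cases "x - t \<le> m * (t + 2)")
    case True
    then show ?thesis using that[of t] Suc.prems by simp
  next
    case False
    show ?thesis
    proof (cases m)
      case 0
      then have "x = t + 1 \<or> x = t + 2" using False Suc.prems by auto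
      then show ?thesis using that[of x] 0 by auto
    next
      case (Suc m')
      then show ?thesis using that[of "t + 2"] False Suc.prems by simp
    qed
  qed
  have "x - d \<notin> B" using Suc.IH d by blast
  then show ?case using d(1,2) assms(1) by (auto simp: closed_sets_def closed_sub_def)
qed

lemma cell_value_image_closed:
  assumes "I \<in> cell_ideals t"
  shows "cell_value t ` I \<in> closed_sets t"
proof -
  have sub: "h - d \<in> cell_value t ` I"
    if hd: "h \<in> cell_value t ` I" "d \<le> h" "d \<in> {t, t + 1, t + 2}" for h d
  proof -
    obtain k j where kj: "(k, j) \<in> I" "h = cell_value t (k, j)"
      using hd(1) by auto
    then have h: "h = k * (t + 2) + (j + 1)" by (simp add: cell_value_def)
    have cell: "j + 2 * k + 1 < t"
      using assms kj(1) by (auto simp: cell_ideals_def cells_def)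
    \<comment> \<open>A cell in row 0 has value \<open>j + 1 < t \<le> d\<close>, so the subtraction
      starts from a higher row.\<close>
    obtain k' where k': "k = Suc k'" using h cell hd(2,3) by (cases k) auto
    have "(k', j + (t + 2 - d)) \<in> I"
      using kj(1) k' assms hd(3) by (auto simp: cell_ideals_def numeral_2_eq_2)
    moreover have "h - d = cell_value t (k', j + (t + 2 - d))"
      using h k' hd(3) by (auto simp: cell_value_def)
    ultimately show ?thesis by blast
  qed
  have "finite I" using assms finite_cells finite_subset by (auto simp: cell_ideals_def)
  moreover have "0 \<notin> cell_value t ` I" by (auto simp: cell_value_def)
  ultimately show ?thesis using sub by (simp add: closed_sets_def closed_sub_def)
qed

lemma closed_set_is_cell_value_image:
  assumes B: "B \<in> closed_sets t" and t: "1 \<le> t"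
  shows "\<exists>I\<in>cell_ideals t. B = cell_value t ` I"
proof -
  define I where "I = {c \<in> cells t. cell_value t c \<in> B}"
  note avoid = closed_sets_avoid_semigroup[OF B t]
  have sub: "h - d \<in> B" if "h \<in> B" "d \<le> h" "d \<in> {t, t + 1, t + 2}" for h d
    using B that by (auto simp: closed_sets_def closed_sub_def)
  have "I \<in> cell_ideals t"
    unfolding cell_ideals_def
  proof (intro CollectI conjI allI impI)
    fix k j assume "(Suc k, j) \<in> I"
    then have h: "Suc k * (t + 2) + (j + 1) \<in> B" and cell: "j + 2 * Suc k + 1 < t"
      by (auto simp: I_def cells_def cell_value_def)
    show "(k, j) \<in> I" "(k, j + 1) \<in> I" "(k, j + 2) \<in> I"
      using sub[OF h, of "t + 2"] sub[OF h, of "t + 1"] sub[OF h, of t] cell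
      by (simp_all add: I_def cells_def cell_value_def algebra_simps numeral_eq_Suc)
  qed (auto simp: I_def)
  moreover have "B = cell_value t ` I"
  proof (intro equalityI subsetI)
    fix x assume x: "x \<in> B"
    define k r where "k = x div (t + 2)" and "r = x mod (t + 2)"
    have xkr: "x = k * (t + 2) + r" unfolding k_def r_def by (rule div_mult_mod_eq[symmetric])
    have "r \<noteq> 0"
    proof
      assume "r = 0"
      then have "k * t \<le> x" "x \<le> k * (t + 2)" using xkr by (simp_all add: distrib_left)
      then show False using avoid x by blast
    qed
    then obtain j where j: "r = j + 1" by (metis Suc_eq_plus1 not0_implies_Suc)
    have "r < t + 2" by (simp add: r_def)
    then have "x \<le> Suc k * (t + 2)" using xkr by simp
    \<comment> \<open>As \<open>x\<close> is below the upper end of interval \<open>Suc k\<close>,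
      avoiding that interval leaves \<open>x < Suc k * t\<close>, which is the cell
      condition.\<close>
    then have "\<not> Suc k * t \<le> x" using avoid[of "Suc k" x] x by blast
    then have "j + 2 * k + 1 < t" using xkr j by (simp add: algebra_simps)
    then show "x \<in> cell_value t ` I"
      using x xkr j by (intro image_eqI[of _ _ "(k, j)"]) (simp_all add: I_def cells_def cell_value_def)
  qed (auto simp: I_def)
  ultimately show ?thesis by blast
qed

lemma bij_betw_cell_ideals:
  assumes "1 \<le> t"
  shows "bij_betw ((`) (cell_value t)) (cell_ideals t) (closed_sets t)"
proof (rule bij_betw_imageI)
  have "cell_ideals t \<subseteq> Pow (cells t)" by (auto simp: cell_ideals_def)
  then show "inj_on ((`) (cell_value t)) (cell_ideals t)"
    using inj_on_image_Pow[OF inj_on_cell_value] inj_on_subset by blast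
  show "(`) (cell_value t) ` cell_ideals t = closed_sets t"
    using cell_value_image_closed closed_set_is_cell_value_image[OF _ assms] by blast
qed

section \<open>Cutting an ideal at its first gap\<close>

text \<open>Each of the \<open>k\<close> steps down may shift by 0, 1 or 2 columns, so every total
  shift up to \<open>2 * k\<close> occurs.\<close>

lemma cell_ideal_base:
  assumes "I \<in> cell_ideals t" "(k, i) \<in> I" "d \<le> 2 * k"
  shows "(0, i + d) \<in> I"
  using assms(2,3)
proof (induction k arbitrary: i d)
  case (Suc k)
  then have up: "(k, i) \<in> I" "(k, i + 1) \<in> I" "(k, i + 2) \<in> I"
    using assms(1) unfolding cell_ideals_def by blast+
  consider "d \<le> 2 * k" | "d = 2 * k + 1" | "d = 2 * k + 2" using Suc.prems(2) by force
  then show ?case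
    using Suc.IH[OF up(1), of d] Suc.IH[OF up(2), of "d - 1"] Suc.IH[OF up(3), of "d - 2"]
    by cases simp_all
qed simp

text \<open>The base of a cell in row 0 is an interval that misses \<open>j\<close>, so the cell
  lies over one side of the gap only.\<close>

lemma cell_ideal_avoid:
  assumes "I \<in> cell_ideals t" "(0, j) \<notin> I" "(k, i) \<in> I"
  shows "i + 2 * k < j \<or> j < i"
proof (rule ccontr)
  assume "\<not> ?thesis"
  then have "j - i \<le> 2 * k" "i + (j - i) = j" by auto
  then show False using cell_ideal_base[OF assms(1,3), of "j - i"] assms(2) by simp
qed

text \<open>If \<open>j\<close> is the first column missing from row 0 of an ideal, the cells left of \<open>j\<close> consist of
  a full row 0 and, above it, an ideal of smaller size, while the cells right of \<open>j\<close> form an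
  independent ideal. For \<open>j = 0\<close> the left size \<open>j - 1\<close> truncates to 0, which correctly leaves
  only the empty left part.\<close>

definition glue :: "nat \<Rightarrow> (nat \<times> nat) set \<Rightarrow> (nat \<times> nat) set \<Rightarrow> (nat \<times> nat) set" where
  "glue j L R = {(k, i). if i < j then k = 0 \<or> (k - 1, i) \<in> L else j < i \<and> (k, i - Suc j) \<in> R}"

definition ideals_first_gap :: "nat \<Rightarrow> nat \<Rightarrow> (nat \<times> nat) set set" where
  "ideals_first_gap t j = {I \<in> cell_ideals t. (\<forall>i<j. (0, i) \<in> I) \<and> (0, j) \<notin> I}"

lemma glue_in_ideals_first_gap:
  assumes L: "L \<in> cell_ideals (j - 1)" and R: "R \<in> cell_ideals (t - 1 - j)" and j: "j < t"
  shows "glue j L R \<in> ideals_first_gap t j"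
proof -
  have Lc: "i + 2 * k + 1 < j - 1" if "(k, i) \<in> L" for k i
    using L that by (auto simp: cell_ideals_def cells_def)
  have Rc: "i + 2 * k + 1 < t - 1 - j" if "(k, i) \<in> R" for k i
    using R that by (auto simp: cell_ideals_def cells_def)
  have Ls: "(k, i) \<in> L" "(k, i + 1) \<in> L" "(k, i + 2) \<in> L" if "(Suc k, i) \<in> L" for k i
    using L that unfolding cell_ideals_def by blast+
  have Rs: "(k, i) \<in> R" "(k, i + 1) \<in> R" "(k, i + 2) \<in> R" if "(Suc k, i) \<in> R" for k i
    using R that unfolding cell_ideals_def by blast+
  have "glue j L R \<in> cell_ideals t"
    unfolding cell_ideals_def
  proof (intro CollectI conjI allI impI)
    show "glue j L R \<subseteq> cells t"
    proof
      fix c assume c: "c \<in> glue j L R"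
      obtain k i where ki: "c = (k, i)" by force
      have "i + 2 * k + 1 < t"
      proof (cases "i < j")
        case True
        then show ?thesis using c ki Lc[of "k - 1" i] j by (cases k) (auto simp: glue_def)
      next
        case False
        then show ?thesis using c ki Rc[of k "i - Suc j"] j by (auto simp: glue_def)
      qed
      then show "c \<in> cells t" using ki by (simp add: cells_def)
    qed
  next
    fix k i assume c: "(Suc k, i) \<in> glue j L R"
    have "(k, i) \<in> glue j L R \<and> (k, i + 1) \<in> glue j L R \<and> (k, i + 2) \<in> glue j L R"
    proof (cases "i < j")
      \<comment> \<open>Cells of \<open>L\<close> satisfy \<open>i + 2 * k + 1 < j - 1\<close>, so
        columns \<open>i + 1\<close> and \<open>i + 2\<close> are still left of the gap. For
        \<open>k = 0\<close> the three cells lie in the full row 0.\<close>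
      case True
      then have "(k, i) \<in> L" using c by (simp add: glue_def)
      then show ?thesis using True Lc[of k i] Ls[of "k - 1" i] by (cases k) (auto simp: glue_def)
    next
      case False
      then have "j < i" "(Suc k, i - Suc j) \<in> R" using c by (auto simp: glue_def)
      moreover have "i + 1 - Suc j = i - Suc j + 1" "i + 2 - Suc j = i - Suc j + 2"
        using \<open>j < i\<close> by auto
      ultimately show ?thesis using Rs[of k "i - Suc j"] by (auto simp: glue_def simp del: diff_Suc_Suc)
    qed
    then show "(k, i) \<in> glue j L R" "(k, i + 1) \<in> glue j L R" "(k, i + 2) \<in> glue j L R"
      by blast+
  qed
  then show ?thesis by (auto simp: ideals_first_gap_def glue_def)
qed

text \<open>The two parts undo \<open>glue\<close>: the left one loses its full row 0, the right one
  moves back by \<open>j + 1\<close> columns, the gap included.\<close>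

definition left_part :: "nat \<Rightarrow> (nat \<times> nat) set \<Rightarrow> (nat \<times> nat) set" where
  "left_part j I = {(k, i). i < j \<and> (Suc k, i) \<in> I}"

definition right_part :: "nat \<Rightarrow> (nat \<times> nat) set \<Rightarrow> (nat \<times> nat) set" where
  "right_part j I = {(k, i). (k, i + Suc j) \<in> I}"

text \<open>A cell in row \<open>Suc k\<close> left of the gap has its base within the first
  \<open>j\<close> columns, so \<open>i + 2 * Suc k < j\<close>; once row 0 is dropped this is the
  condition for \<open>cells (j - 1)\<close>.\<close>

lemma left_part_ideal:
  assumes "I \<in> ideals_first_gap t j"
  shows "left_part j I \<in> cell_ideals (j - 1)"
proof -
  have I: "I \<in> cell_ideals t" "(0, j) \<notin> I" using assms by (auto simp: ideals_first_gap_def)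
  have c: "i + 2 * Suc k < j" if "i < j" "(Suc k, i) \<in> I" for k i
    using cell_ideal_avoid[OF I that(2)] that(1) by auto
  have s: "(k, i) \<in> I" "(k, i + 1) \<in> I" "(k, i + 2) \<in> I" if "(Suc k, i) \<in> I" for k i
    using I(1) that unfolding cell_ideals_def by blast+
  show ?thesis
    unfolding cell_ideals_def
  proof (intro CollectI conjI allI impI)
    show "left_part j I \<subseteq> cells (j - 1)"
      using c by (force simp: left_part_def cells_def)
  next
    fix k i assume "(Suc k, i) \<in> left_part j I"
    then have *: "i < j" "(Suc (Suc k), i) \<in> I" by (auto simp: left_part_def)
    then show "(k, i) \<in> left_part j I" "(k, i + 1) \<in> left_part j I" "(k, i + 2) \<in> left_part j I"
      using c[OF *] s[OF *(2)] by (auto simp: left_part_def)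
  qed
qed

lemma right_part_ideal:
  assumes "I \<in> cell_ideals t"
  shows "right_part j I \<in> cell_ideals (t - 1 - j)"
proof -
  have c: "i + 2 * k + 1 < t" if "(k, i) \<in> I" for k i
    using assms that by (auto simp: cell_ideals_def cells_def)
  have s: "(k, i) \<in> I" "(k, i + 1) \<in> I" "(k, i + 2) \<in> I" if "(Suc k, i) \<in> I" for k i
    using assms that unfolding cell_ideals_def by blast+
  show ?thesis
    unfolding cell_ideals_def
  proof (intro CollectI conjI allI impI)
    show "right_part j I \<subseteq> cells (t - 1 - j)"
      by (auto simp: right_part_def cells_def dest!: c)
  next
    fix k i assume "(Suc k, i) \<in> right_part j I"
    then have "(Suc k, i + Suc j) \<in> I" by (auto simp: right_part_def)
    from s[OF this] show "(k, i) \<in> right_part j I" "(k, i + 1) \<in> right_part j I"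
      "(k, i + 2) \<in> right_part j I"
      by (auto simp: right_part_def)
  qed
qed

lemma glue_parts:
  assumes "I \<in> ideals_first_gap t j"
  shows "glue j (left_part j I) (right_part j I) = I"
proof (intro set_eqI)
  fix c :: "nat \<times> nat"
  obtain k i where ki: "c = (k, i)" by force
  have I: "I \<in> cell_ideals t" "(0, j) \<notin> I" "\<forall>i<j. (0, i) \<in> I"
    using assms by (auto simp: ideals_first_gap_def)
  consider "i < j" | "i = j" | "j < i" by linarith
  then show "c \<in> glue j (left_part j I) (right_part j I) \<longleftrightarrow> c \<in> I"
  proof cases
    case 1
    then show ?thesis using I(3) ki by (cases k) (auto simp: glue_def left_part_def)
  next
    \<comment> \<open>Column \<open>j\<close> is empty: the base of a cell there would contain the
      gap.\<close>
    case 2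
    then show ?thesis using cell_ideal_avoid[OF I(1,2), of k i] ki by (auto simp: glue_def)
  next
    case 3
    then show ?thesis using ki by (simp add: glue_def right_part_def)
  qed
qed

lemma left_part_glue:
  assumes "L \<in> cell_ideals (j - 1)"
  shows "left_part j (glue j L R) = L"
  using assms by (auto simp: left_part_def glue_def cell_ideals_def cells_def)

lemma right_part_glue: "right_part j (glue j L R) = R"
  by (auto simp: right_part_def glue_def)

lemma card_ideals_first_gap:
  assumes "j < t"
  shows "card (ideals_first_gap t j) = card (cell_ideals (j - 1)) * card (cell_ideals (t - 1 - j))"
proof -
  have "bij_betw (\<lambda>(L, R). glue j L R) (cell_ideals (j - 1) \<times> cell_ideals (t - 1 - j)) (ideals_first_gap t j)"
  proof (rule bij_betw_byWitness[where f' = "\<lambda>I. (left_part j I, right_part j I)"])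
    show "(\<lambda>(L, R). glue j L R) ` (cell_ideals (j - 1) \<times> cell_ideals (t - 1 - j)) \<subseteq> ideals_first_gap t j"
      using glue_in_ideals_first_gap assms by auto
    show "(\<lambda>I. (left_part j I, right_part j I)) ` ideals_first_gap t j
        \<subseteq> cell_ideals (j - 1) \<times> cell_ideals (t - 1 - j)"
      using left_part_ideal right_part_ideal by (auto simp: ideals_first_gap_def)
  qed (auto simp: left_part_glue right_part_glue glue_parts)
  then show ?thesis using bij_betw_same_card card_cartesian_product by metis
qed

text \<open>Column \<open>t - 1\<close> of row 0 is already outside \<open>cells t\<close>, so a
  first gap exists and is below \<open>t\<close>.\<close>

lemma cell_ideals_decompose:
  assumes "1 \<le> t"
  shows "cell_ideals t = (\<Union>j\<in>{..<t}. ideals_first_gap t j)"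
proof (intro equalityI subsetI)
  fix I assume I: "I \<in> cell_ideals t"
  then have gap: "(0, t - 1) \<notin> I" by (auto simp: cell_ideals_def cells_def)
  define j where "j = (LEAST j. (0, j) \<notin> I)"
  have "(0, j) \<notin> I" unfolding j_def using gap by (rule LeastI)
  moreover have "\<forall>i<j. (0, i) \<in> I" unfolding j_def using not_less_Least by blast
  moreover have "j \<le> t - 1" unfolding j_def using gap by (rule Least_le)
  ultimately have "I \<in> ideals_first_gap t j" "j < t"
    using I assms by (auto simp: ideals_first_gap_def)
  then show "I \<in> (\<Union>j\<in>{..<t}. ideals_first_gap t j)" by blast
qed (auto simp: ideals_first_gap_def)

section \<open>Recurrence and functional equation\<close>

lemma card_cell_ideals_rec:
  assumes "1 \<le> t"
  shows "card (cell_ideals t) = (\<Sum>j<t. card (cell_ideals (j - 1)) * card (cell_ideals (t - 1 - j)))"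
proof -
  have "card (cell_ideals t) = (\<Sum>j<t. card (ideals_first_gap t j))"
    unfolding cell_ideals_decompose[OF assms]
  proof (rule card_UN_disjoint)
    show "\<forall>j\<in>{..<t}. finite (ideals_first_gap t j)"
      by (auto simp: ideals_first_gap_def finite_cell_ideals)
    show "\<forall>i\<in>{..<t}. \<forall>j\<in>{..<t}. i \<noteq> j \<longrightarrow> ideals_first_gap t i \<inter> ideals_first_gap t j = {}"
      by (auto simp: ideals_first_gap_def) (meson linorder_neqE_nat)
  qed simp
  then show ?thesis by (simp add: card_ideals_first_gap)
qed

lemma cell_ideals_0: "cell_ideals 0 = {{}}"
  by (auto simp: cell_ideals_def cells_def)

unbundle fps_syntax

lemma cell_ideals_fps:
  defines "F \<equiv> Abs_fps (\<lambda>t. real (card (cell_ideals t)))"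
  shows "F = 1 + fps_X * F + fps_X ^ 2 * F ^ 2"
proof -
  \<comment> \<open>The truncated index \<open>j - 1\<close> makes the coefficients of
    \<open>G\<close> those of \<open>F\<close> shifted by one, preceded by 1; the recurrence is then
    the convolution of \<open>G\<close> and \<open>F\<close>.\<close>
  define G where "G = Abs_fps (\<lambda>j. real (card (cell_ideals (j - 1))))"
  have G: "G = 1 + fps_X * F"
  proof (rule fps_ext)
    fix n show "G $ n = (1 + fps_X * F) $ n"
      by (cases n) (simp_all add: G_def F_def cell_ideals_0)
  qed
  have "F = 1 + fps_X * (G * F)"
  proof (rule fps_ext)
    fix n show "F $ n = (1 + fps_X * (G * F)) $ n"
    proof (cases n)
      case (Suc m)
      have "F $ Suc m = (\<Sum>j<Suc m. real (card (cell_ideals (j - 1))) * real (card (cell_ideals (m - j))))"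
        using card_cell_ideals_rec[of "Suc m"] by (simp add: F_def)
      also have "\<dots> = (G * F) $ m"
        by (simp add: fps_mult_nth G_def F_def atLeast0AtMost lessThan_Suc_atMost)
      finally show ?thesis using Suc by simp
    qed (simp add: F_def cell_ideals_0)
  qed
  then show ?thesis unfolding G by (simp add: algebra_simps power2_eq_square)
qed

section \<open>The Motzkin generating function\<close>

definition catalan_fps :: "real fps" where
  "catalan_fps = Abs_fps (\<lambda>k. real ((2 * k) choose k) / (real k + 1))"

text \<open>Two absorption identities, joined by the symmetry of row \<open>2 * k + 1\<close> of
  Pascal's triangle.\<close>

lemma central_binomial_Suc:
  "(real k + 1) * real ((2 * Suc k) choose Suc k) = 2 * (2 * real k + 1) * real ((2 * k) choose k)"
proof -
  have 1: "Suc k * (Suc (Suc (2*k)) choose Suc k) = Suc (Suc (2 * k)) * (Suc (2 * k) choose k)"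
    by (rule Suc_times_binomial)
  have 3: "Suc k * (Suc (2*k) choose Suc k) = Suc (2 * k) * (2 * k choose k)"
    by (rule Suc_times_binomial)
  have 4: "Suc (2*k) choose Suc k = Suc (2*k) choose k"
    using binomial_symmetric[of "Suc k" "Suc (2 * k)"] by simp
  have "Suc k * (Suc k * (Suc (Suc (2*k)) choose Suc k)) = Suc (Suc (2 * k)) * (Suc (2 * k) * (2 * k choose k))"
    unfolding 1 3[unfolded 4, symmetric] by (rule mult.left_commute)
  also have "\<dots> = Suc k * (2 * Suc (2 * k) * (2 * k choose k))"
    by (simp add: algebra_simps)
  finally have "Suc k * (Suc (Suc (2*k)) choose Suc k) = 2 * Suc (2 * k) * (2 * k choose k)"
    by (simp only: mult_cancel1) simp
  then have "real (Suc k * (Suc (Suc (2*k)) choose Suc k)) = real (2 * Suc (2 * k) * (2 * k choose k))"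
    by (rule arg_cong)
  then show ?thesis by (simp add: algebra_simps del: binomial_Suc_Suc)
qed

text \<open>Both sides satisfy the same recurrence: \<open>k + 2\<close> times the next value is
  \<open>4 * k + 2\<close> times the current one.\<close>

lemma gbinomial_half_Suc:
  "((1 / 2 :: real) gchoose Suc k) * (-4) ^ Suc k = - 2 * catalan_fps $ k"
proof (induction k)
  case 0
  show ?case by (simp add: catalan_fps_def)
next
  case (Suc k)
  have "(1 / 2 :: real) * ((1 / 2) gchoose Suc k) = of_nat (Suc k) * ((1 / 2) gchoose Suc k)
      + of_nat (Suc (Suc k)) * ((1 / 2) gchoose Suc (Suc k))"
    by (rule gbinomial_mult_1)
  then have "(real k + 2) * ((1 / 2 :: real) gchoose Suc (Suc k))
      = - (real k + 1 / 2) * ((1 / 2) gchoose Suc k)"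
    by (simp add: algebra_simps)
  then have "(real k + 2) * ((1 / 2 :: real) gchoose Suc (Suc k)) * (-4) ^ Suc (Suc k)
      = - (real k + 1 / 2) * ((1 / 2) gchoose Suc k) * (-4) ^ Suc (Suc k)"
    by simp
  then have "(real k + 2) * (((1 / 2 :: real) gchoose Suc (Suc k)) * (-4) ^ Suc (Suc k))
      = (4 * real k + 2) * (((1 / 2) gchoose Suc k) * (-4) ^ Suc k)"
    unfolding power_Suc[of "-4" "Suc k"] by (simp only: mult_ac) (simp add: algebra_simps)
  also have "\<dots> = (real k + 2) * (- 2 * catalan_fps $ Suc k)"
    unfolding Suc.IH using central_binomial_Suc[of k]
    by (simp add: catalan_fps_def field_simps del: binomial_Suc_Suc)
  finally show ?case
    by (simp only: mult_cancel_left) linarith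
qed

text \<open>By the previous lemma \<open>1 - 2 y C\<close> is the binomial series of \<open>(1 - 4 y)^(1 / 2)\<close>, so its square
  is \<open>1 - 4 y\<close>.\<close>

lemma catalan_fps_eq: "catalan_fps = 1 + fps_X * catalan_fps ^ 2"
proof -
  define Q where "Q = 1 - 2 * fps_X * catalan_fps"
  have Q: "Q $ n = ((1 / 2) gchoose n) * (-4) ^ n" for n
    using gbinomial_half_Suc[of "n - 1"]
    by (cases n) (simp_all add: Q_def mult.assoc numeral_fps_const)
  have "(Q * Q) $ n = (1 - 4 * fps_X) $ n" for n
  proof -
    have "(Q * Q) $ n = (\<Sum>i=0..n. ((1 / 2) gchoose i) * ((1 / 2) gchoose (n - i))) * (-4) ^ n"
      unfolding fps_mult_nth Q sum_distrib_right
      by (intro sum.cong refl) (simp add: power_add[symmetric])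
    \<comment> \<open>Vandermonde convolution with 1/2 + 1/2 = 1.\<close>
    also have "\<dots> = (1 gchoose n) * (-4) ^ n"
      by (simp add: gbinomial_Vandermonde)
    also have "\<dots> = (1 choose n) * (-4) ^ n"
      using binomial_gbinomial[of 1 n, where ?'a = real] by simp
    also have "\<dots> = (1 - 4 * fps_X) $ n"
    proof (cases "n \<le> 1")
      case True
      then consider "n = 0" | "n = 1" by linarith
      then show ?thesis by cases (simp_all add: numeral_fps_const)
    qed (simp add: numeral_fps_const binomial_eq_0)
    finally show ?thesis .
  qed
  then have "Q * Q = 1 - 4 * fps_X" by (rule fps_ext)
  then have "4 * fps_X * (catalan_fps - (1 + fps_X * catalan_fps ^ 2)) = 0"
    unfolding Q_def by (simp add: algebra_simps power2_eq_square)
  then show ?thesis by simp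
qed

section \<open>Binomial columns and the Motzkin series\<close>

text \<open>By Pascal's rule, multiplying the series of column \<open>Suc k\<close> by
  \<open>1 - fps_X\<close> gives \<open>fps_X\<close> times the series of column
  \<open>k\<close>.\<close>

lemma one_minus_X_power_binomial:
  "(1 - fps_X) ^ Suc k * Abs_fps (\<lambda>n. of_nat (n choose k)) = (fps_X ^ k :: 'a::comm_ring_1 fps)"
proof (induction k)
  case 0
  show ?case
    by (rule fps_ext) (simp add: left_diff_distrib)
next
  case (Suc k)
  have "(1 - fps_X) * Abs_fps (\<lambda>n. of_nat (n choose Suc k))
      = (fps_X * Abs_fps (\<lambda>n. of_nat (n choose k)) :: 'a fps)"
  proof (rule fps_ext)
    fix n show "((1 - fps_X) * Abs_fps (\<lambda>n. of_nat (n choose Suc k))) $ n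
      = (fps_X * Abs_fps (\<lambda>n. of_nat (n choose k)) :: 'a fps) $ n"
      by (cases n) (simp_all add: left_diff_distrib)
  qed
  then have "(1 - fps_X) ^ Suc k * ((1 - fps_X) * Abs_fps (\<lambda>n. of_nat (n choose Suc k)))
      = (1 - fps_X) ^ Suc k * (fps_X * Abs_fps (\<lambda>n. of_nat (n choose k)) :: 'a fps)"
    by (rule arg_cong)
  also have "\<dots> = fps_X * ((1 - fps_X) ^ Suc k * Abs_fps (\<lambda>n. of_nat (n choose k)))"
    by (rule mult.left_commute)
  also have "\<dots> = fps_X ^ Suc k" by (simp only: Suc.IH power_Suc[of fps_X])
  finally show ?case by (simp only: power_Suc2[of _ "Suc k"] mult.assoc)
qed

definition motzkin_number :: "nat \<Rightarrow> real" where
  "motzkin_number t =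
     (\<Sum>k = 0..t div 2. 1 / (real k + 1) * real (t choose (2 * k)) * real ((2 * k) choose k))"

text \<open>Since \<open>b ^ i\<close> has no terms below degree \<open>i\<close>, all inner sums
  may run up to the same \<open>n\<close> and can be exchanged.\<close>

lemma fps_compose_mult_nth:
  fixes a b c :: "'a::comm_ring_1 fps"
  assumes "b $ 0 = 0"
  shows "((a oo b) * c) $ n = (\<Sum>i=0..n. a $ i * (b ^ i * c) $ n)"
proof -
  have *: "(a oo b) $ m = (\<Sum>i=0..n. a $ i * (b ^ i $ m))" if "m \<le> n" for m
    unfolding fps_compose_nth using that assms
    by (intro sum.mono_neutral_left) (auto simp: startsby_zero_power_prefix)
  have "((a oo b) * c) $ n = (\<Sum>m=0..n. \<Sum>i=0..n. a $ i * (b ^ i $ m) * c $ (n - m))"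
    unfolding fps_mult_nth by (intro sum.cong refl) (simp add: * sum_distrib_right)
  also have "\<dots> = (\<Sum>i=0..n. \<Sum>m=0..n. a $ i * (b ^ i $ m) * c $ (n - m))"
    by (rule sum.swap)
  finally show ?thesis
    by (simp add: fps_mult_nth sum_distrib_left mult.assoc)
qed

text \<open>Since \<open>\<Sum>n. (n choose 2 k) x^n = x^(2 k) / (1 - x)^(2 k + 1)\<close>, the Motzkin series is
  \<open>C (x^2 / (1 - x)^2) / (1 - x)\<close> with \<open>C\<close> the Catalan series, and \<open>C = 1 + y C^2\<close> transfers.\<close>

lemma motzkin_number_fps:
  defines "M \<equiv> Abs_fps motzkin_number"
  shows "M = 1 + fps_X * M + fps_X ^ 2 * M ^ 2"
proof -
  define J :: "real fps" where "J = inverse (1 - fps_X)"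
  have J: "(1 - fps_X) * J = 1" unfolding J_def
    using inverse_mult_eq_1'[of "1 - fps_X :: real fps"] by simp
  then have J': "J * (1 - fps_X) = 1" by (simp add: mult.commute)
  define b where "b = (fps_X * J) ^ 2"
  have b0: "b $ 0 = 0" by (simp add: b_def)
  have coeff: "(b ^ i * J) $ n = real (n choose (2 * i))" for i n
  proof -
    have "b ^ i * J = J ^ Suc (2 * i) * fps_X ^ (2 * i)"
      by (simp add: b_def power_mult_distrib power_mult [symmetric])
    also have "\<dots> = J ^ Suc (2 * i) * ((1 - fps_X) ^ Suc (2 * i) * Abs_fps (\<lambda>n. of_nat (n choose (2 * i))))"
      by (simp only: one_minus_X_power_binomial)
    also have "\<dots> = ((1 - fps_X) * J) ^ Suc (2 * i) * Abs_fps (\<lambda>n. of_nat (n choose (2 * i)))"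
      by (simp only: power_mult_distrib mult_ac)
    finally show ?thesis by (simp add: J)
  qed
  define K where "K = catalan_fps oo b"
  have M: "M = K * J"
  proof (rule fps_ext)
    fix n
    have "(K * J) $ n = (\<Sum>i=0..n. catalan_fps $ i * real (n choose (2 * i)))"
      by (simp add: K_def fps_compose_mult_nth b0 coeff)
    also have "\<dots> = (\<Sum>i=0..n div 2. catalan_fps $ i * real (n choose (2 * i)))"
      by (intro sum.mono_neutral_right) (auto simp: binomial_eq_0_iff)
    finally show "M $ n = (K * J) $ n"
      by (simp add: M_def motzkin_number_def catalan_fps_def mult_ac)
  qed
  have K: "K = 1 + b * K ^ 2"
    unfolding K_def
    by (subst catalan_fps_eq)
       (simp add: fps_compose_add_distrib fps_compose_mult_distrib b0 fps_compose_power)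
  \<comment> \<open>The left side is \<open>K\<close>, and \<open>b * K ^ 2\<close> equals
    \<open>fps_X ^ 2 * M ^ 2\<close> because \<open>M = K * J\<close>.\<close>
  have "(1 - fps_X) * M = ((1 - fps_X) * J) * K" by (simp add: M)
  also have "\<dots> = 1 + fps_X ^ 2 * M ^ 2"
    by (subst K) (simp add: J J' b_def M power_mult_distrib mult.left_commute mult.commute)
  finally show ?thesis by (simp add: algebra_simps)
qed

section \<open>Solving the quadratic equation\<close>

text \<open>The difference of the equations factors through \<open>F - G\<close>; the cofactor has
  constant coefficient 1, so it is nonzero and cancels.\<close>

lemma motzkin_fps_unique:
  fixes F G :: "'a::idom fps"
  assumes F: "F = 1 + fps_X * F + fps_X ^ 2 * F ^ 2" and G: "G = 1 + fps_X * G + fps_X ^ 2 * G ^ 2"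
  shows "F = G"
proof -
  have "(F - G) * (1 - fps_X - fps_X ^ 2 * (F + G))
      = (F - (fps_X * F + fps_X ^ 2 * F ^ 2)) - (G - (fps_X * G + fps_X ^ 2 * G ^ 2))"
    by (simp add: algebra_simps power2_eq_square)
  also have "F - (fps_X * F + fps_X ^ 2 * F ^ 2) = 1" using F by (metis add.assoc add_diff_cancel_right')
  also have "G - (fps_X * G + fps_X ^ 2 * G ^ 2) = 1" using G by (metis add.assoc add_diff_cancel_right')
  finally have "(F - G) * (1 - fps_X - fps_X ^ 2 * (F + G)) = 0" by simp
  moreover have "(1 - fps_X - fps_X ^ 2 * (F + G)) $ 0 = 1" by (simp add: power2_eq_square mult.assoc)
  then have "1 - fps_X - fps_X ^ 2 * (F + G) \<noteq> 0" by (metis fps_zero_nth zero_neq_one)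
  ultimately show ?thesis by simp
qed

text \<open>Completing the square: the discriminant \<open>(1 - fps_X) ^ 2 - 4 * fps_X ^ 2\<close>
  is the square of the right side, whose constant coefficient 1 selects the root.\<close>

lemma motzkin_fps_radical:
  fixes F :: "real fps"
  assumes F: "F = 1 + fps_X * F + fps_X ^ 2 * F ^ 2"
  shows "fps_radical root 2 (1 - 2 * fps_X - 3 * fps_X ^ 2) = 1 - fps_X - 2 * fps_X ^ 2 * F"
proof -
  let ?b = "1 - 2 * fps_X - 3 * fps_X ^ 2 :: real fps"
  let ?a = "1 - fps_X - 2 * fps_X ^ 2 * F"
  have *: "fps_X ^ 2 * F ^ 2 = F - 1 - fps_X * F" using F by (simp add: algebra_simps)
  have "?a ^ 2 = (1 - fps_X) ^ 2 - 4 * fps_X ^ 2 * (1 - fps_X) * F + 4 * fps_X ^ 2 * (fps_X ^ 2 * F ^ 2)"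
    by (simp add: algebra_simps power2_eq_square)
  also have "\<dots> = (1 - fps_X) ^ 2 - 4 * fps_X ^ 2 * (1 - fps_X) * F + 4 * fps_X ^ 2 * (F - 1 - fps_X * F)"
    by (simp only: *)
  also have "\<dots> = ?b" by (simp add: algebra_simps power2_eq_square)
  finally have "?a ^ 2 = ?b" .
  moreover have "?a $ 0 = 1" "?b $ 0 = 1" by (simp_all add: power2_eq_square mult.assoc numeral_fps_const)
  ultimately show ?thesis
    using radical_unique[of root 1 ?b ?a] by (simp add: numeral_2_eq_2)
qed

lemma motzkin_fps_quotient:
  fixes F :: "real fps"
  assumes F: "F = 1 + fps_X * F + fps_X ^ 2 * F ^ 2"
  defines "N \<equiv> 1 - fps_X - fps_radical root 2 (1 - 2 * fps_X - 3 * fps_X ^ 2)"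
  shows "2 * fps_X ^ 2 dvd N" "F = N / (2 * fps_X ^ 2)"
proof -
  have "N = 2 * fps_X ^ 2 * F" unfolding N_def motzkin_fps_radical[OF F] by simp
  then show "2 * fps_X ^ 2 dvd N" "F = N / (2 * fps_X ^ 2)" by simp_all
qed

unbundle no fps_syntax

theorem theorem1p2:
  fixes f :: "nat \<Rightarrow> nat"
  assumes f_0: "f 0 = 1"
    and f_pos: "\<And>t. t \<ge> 1 \<Longrightarrow> f t = card (simultaneous_cores [t, t + 1, t + 2])"
  defines "N \<equiv> 1 - fps_X - fps_radical root 2 (1 - 2 * fps_X - 3 * fps_X ^ 2) :: real fps"
  shows "(\<forall>t\<ge>1. finite (simultaneous_cores [t, t + 1, t + 2]))
       \<and> (\<forall>t. real (f t) =
             (\<Sum>k = 0..t div 2. 1 / (real k + 1) * real (t choose (2 * k)) * real ((2 * k) choose k)))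
       \<and> 2 * fps_X ^ 2 dvd N
       \<and> Abs_fps (\<lambda>t. real (f t)) = N / (2 * fps_X ^ 2)"
proof -
  \<comment> \<open>For positive \<open>t\<close> two bijections link cores to ideals; at
    \<open>t = 0\<close> the empty ideal alone matches the convention
    \<open>f 0 = 1\<close>.\<close>
  have f_ideals: "f t = card (cell_ideals t)" for t
  proof (cases "t = 0")
    case False
    then have t: "1 \<le> t" by simp
    show ?thesis
      using f_pos[OF t] bij_betw_same_card[OF bij_betw_simultaneous_cores[OF t]]
        bij_betw_same_card[OF bij_betw_cell_ideals[OF t]] by simp
  qed (simp add: f_0 cell_ideals_0)
  let ?F = "Abs_fps (\<lambda>t. real (f t))"
  have F: "?F = 1 + fps_X * ?F + fps_X ^ 2 * ?F ^ 2"
    unfolding f_ideals by (rule cell_ideals_fps)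
  have "?F = Abs_fps motzkin_number"
    by (rule motzkin_fps_unique[OF F motzkin_number_fps])
  then have "real (f t) = motzkin_number t" for t
    by (metis fps_nth_Abs_fps)
  moreover have "finite (simultaneous_cores [t, t + 1, t + 2])" if "1 \<le> t" for t
    using bij_betw_finite[OF bij_betw_simultaneous_cores[OF that]]
      bij_betw_finite[OF bij_betw_cell_ideals[OF that]] finite_cell_ideals by blast
  ultimately show ?thesis
    using motzkin_fps_quotient[OF F] unfolding N_def motzkin_number_def by blast
qed

end
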